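(* Let $K$ be a field such that every polynomial of prime degree in $K[x]$ has a root in $K$. Then $K$ is algebraically closed.
   Context: A polynomial of prime degree is a polynomial whose degree is a prime number. Fields are commutative. *)

theory Defs
  imports "HOL-Computational_Algebra.Computational_Algebra"
begin

end

theory Submission
  imports "HOL-Algebra.Exponent" "HOL-Algebra.Algebraic_Closure_Type" Defs
begin

text \<open>
  The degrees of the rootless polynomials over \<open>K\<close> form an additive monoid without primes. A
  numerical semigroup with greatest common divisor 1 contains all large numbers, so some prime \<open>p\<close>
  divides all these degrees. Laplace's argument for the fundamental theorem of algebra then works with
  \<open>p\<close> in place of 2, by induction on the multiplicity of \<open>p\<close> in the degree \<open>n\<close> of \<open>f\<close>. Let
  \<open>x\<^sub>i\<close> be the roots of \<open>f\<close> in an algebraic closure. For \<open>c \<in> K\<close>, the polynomial with roots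
  \<open>\<Prod>i\<in>S. x\<^sub>i - c\<close>, where \<open>S\<close> ranges over the \<open>p\<close>-element sets of indices, has coefficients in
  \<open>K\<close> and degree \<open>n choose p\<close>, in which \<open>p\<close> has smaller multiplicity. So one of these products
  lies in \<open>K\<close>. Since \<open>K\<close> is infinite, the same \<open>S\<close> occurs for infinitely many \<open>c\<close>; then
  \<open>\<Prod>i\<in>S. (X - x\<^sub>i)\<close> has coefficients in \<open>K\<close> and degree \<open>p\<close>, and its root in \<open>K\<close> is a root of \<open>f\<close>.

  The theory of symmetric polynomials is avoided by multiplicative analogues of Newton's identities,
  together with the fact that a polynomial taking values in \<open>K\<close> at infinitely many points of \<open>K\<close> has
  its coefficients in \<open>K\<close>.
\<close>

hide_const (open) Divisibility.prime

section \<open>Numerical semigroups\<close>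

lemma numerical_semigroup_without_primes:
  fixes B :: "nat set"
  assumes add: "\<And>a b. a \<in> B \<Longrightarrow> b \<in> B \<Longrightarrow> a + b \<in> B"
    and "0 \<in> B" and no_prime: "\<And>b. b \<in> B \<Longrightarrow> \<not> prime b"
  obtains p :: nat where "prime p" "\<And>b. b \<in> B \<Longrightarrow> p dvd b"
proof (cases "B \<subseteq> {0}")
  case True
  then show ?thesis using that[of 2] by auto
next
  case False
  then obtain b0 where b0: "b0 \<in> B" "b0 > 0" by auto
  have mult: "m * b \<in> B" if "b \<in> B" for m b
    using that \<open>0 \<in> B\<close> by (induction m) (auto intro: add)
  \<comment> \<open>The differences of elements of \<open>B\<close> form a subgroup of the integers with generator \<open>d\<close>.\<close>
  define D where "D = (\<lambda>d. d > 0 \<and> (\<exists>y\<in>B. y + d \<in> B))"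
  define d where "d = (LEAST d. D d)"
  have "D b0" unfolding D_def using b0 \<open>0 \<in> B\<close> by (auto intro!: bexI[of _ 0])
  then have "D d" unfolding d_def by (rule LeastI)
  then obtain y where y: "d > 0" "y \<in> B" "y + d \<in> B" by (auto simp: D_def)
  have dvd: "d dvd b" if "b \<in> B" for b
  proof (rule ccontr)
    assume "\<not> d dvd b"
    then have r: "b mod d > 0" by (simp add: mod_greater_zero_iff_not_dvd)
    \<comment> \<open>The remainder is again a difference of two elements of \<open>B\<close>,
      against the minimality of \<open>d\<close>.\<close>
    have "(b div d) * (y + d) + b mod d = (b div d) * y + b"
      by (metis add.assoc add_mult_distrib2 div_mult_mod_eq)
    then have "D (b mod d)"
      unfolding D_def using r add[OF mult[OF y(2)] that] mult[OF y(3)] by metis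
    then have "d \<le> b mod d" unfolding d_def by (rule Least_le)
    then show False using y(1) by (metis mod_less_divisor leD)
  qed
  have "d \<noteq> 1"
  proof
    assume "d = 1"
    have "y > 0"
      using y \<open>d = 1\<close> mult[of 1 2] no_prime[of 2] by (cases y) auto
    \<comment> \<open>Both \<open>y\<close> and \<open>y + 1\<close> are in \<open>B\<close>.
      Writing \<open>q\<close> with \<open>q mod y\<close> copies of \<open>y + 1\<close> leaves a
      nonnegative number of copies of \<open>y\<close>, because \<open>q > y * y\<close>.\<close>
    obtain q where q: "prime q" "q > y * y" using bigger_prime by blast
    have "q div y \<ge> y" using q(2) \<open>y > 0\<close>
      by (metis div_le_mono less_imp_le nonzero_mult_div_cancel_right neq0_conv)
    then have le: "q mod y \<le> q div y"
      using \<open>y > 0\<close> by (meson le_trans less_imp_le mod_less_divisor)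
    have "q = (q div y - q mod y) * y + (q mod y) * (y + 1)"
      using le by (simp add: algebra_simps diff_mult_distrib)
    then have "q \<in> B" using mult[OF y(2)] mult[OF y(3)] add \<open>d = 1\<close> by metis
    then show False using no_prime q(1) by blast
  qed
  then obtain p where "prime p" "p dvd d" using prime_factor_nat by blast
  then show ?thesis using that dvd by (meson dvd_trans)
qed

section \<open>Polynomials with coefficients in an infinite subfield\<close>

locale infinite_subfield =
  fixes K :: "'b :: field set"
  assumes zero_closed [simp, intro]: "0 \<in> K"
    and one_closed [simp, intro]: "1 \<in> K"
    and add_closed [intro]: "\<And>a b. a \<in> K \<Longrightarrow> b \<in> K \<Longrightarrow> a + b \<in> K"
    and uminus_closed [intro]: "\<And>a. a \<in> K \<Longrightarrow> - a \<in> K"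
    and mult_closed [intro]: "\<And>a b. a \<in> K \<Longrightarrow> b \<in> K \<Longrightarrow> a * b \<in> K"
    and inverse_closed [intro]: "\<And>a. a \<in> K \<Longrightarrow> inverse a \<in> K"
    and infinite: "infinite K"
begin

lemma diff_closed [intro]: "a \<in> K \<Longrightarrow> b \<in> K \<Longrightarrow> a - b \<in> K"
  using add_closed[of a "- b"] by auto

lemma divide_closed [intro]: "a \<in> K \<Longrightarrow> b \<in> K \<Longrightarrow> a / b \<in> K"
  by (auto simp: divide_inverse)

lemma power_closed [intro]: "a \<in> K \<Longrightarrow> a ^ n \<in> K"
  by (induction n) auto

lemma sum_closed: "(\<And>i. i \<in> I \<Longrightarrow> f i \<in> K) \<Longrightarrow> sum f I \<in> K"
  by (induction I rule: infinite_finite_induct) auto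

definition polys :: "'b poly set" where
  "polys = {f. \<forall>i. coeff f i \<in> K}"

lemma coeff_closed: "f \<in> polys \<Longrightarrow> coeff f i \<in> K"
  by (simp add: polys_def)

lemma pCons_in_polys [simp]: "pCons a f \<in> polys \<longleftrightarrow> a \<in> K \<and> f \<in> polys"
  by (auto simp: polys_def coeff_pCons split: nat.splits)

lemma zero_in_polys [simp]: "0 \<in> polys"
  by (simp add: polys_def)

lemma one_in_polys [simp]: "1 \<in> polys"
  by (simp add: one_pCons)

lemma add_in_polys: "f \<in> polys \<Longrightarrow> g \<in> polys \<Longrightarrow> f + g \<in> polys"
  by (auto simp: polys_def)

lemma diff_in_polys: "f \<in> polys \<Longrightarrow> g \<in> polys \<Longrightarrow> f - g \<in> polys"
  by (auto simp: polys_def)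

lemma smult_in_polys: "a \<in> K \<Longrightarrow> f \<in> polys \<Longrightarrow> smult a f \<in> polys"
  by (auto simp: polys_def)

lemma mult_in_polys: "f \<in> polys \<Longrightarrow> g \<in> polys \<Longrightarrow> f * g \<in> polys"
  by (auto simp: polys_def coeff_mult intro!: sum_closed)

lemma poly_closed: "f \<in> polys \<Longrightarrow> c \<in> K \<Longrightarrow> poly f c \<in> K"
  by (induction f) auto

lemma pcompose_in_polys: "f \<in> polys \<Longrightarrow> g \<in> polys \<Longrightarrow> pcompose f g \<in> polys"
  by (induction f) (auto simp: pcompose_pCons intro!: add_in_polys mult_in_polys)

text \<open>Split off one point \<open>c\<close>: in f = (X - c) h + f(c), a nonzero quotient
  \<open>h\<close> has smaller degree and takes values in \<open>K\<close> at the remaining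
  points.\<close>

lemma polysI_infinite:
  assumes "infinite {c \<in> K. poly f c \<in> K}"
  shows "f \<in> polys"
  using assms
proof (induction "degree f" arbitrary: f rule: less_induct)
  case less
  let ?A = "\<lambda>f. {c \<in> K. poly f c \<in> K}"
  have "?A f \<noteq> {}" using less.prems by (metis finite.emptyI)
  then obtain c where c: "c \<in> K" "poly f c \<in> K" by blast
  have "poly (f - [:poly f c:]) c = 0" by simp
  then obtain h where h: "f - [:poly f c:] = [:-c, 1:] * h"
    by (metis dvdE poly_eq_0_iff_dvd)
  then have f: "f = [:-c, 1:] * h + [:poly f c:]" by (metis diff_add_cancel)
  have "h \<in> polys"
  proof (cases "h = 0")
    case False
    have "degree ([:-c, 1:] * h) = Suc (degree h)"
      using False by (subst degree_mult_eq) auto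
    then have "degree f = Suc (degree h)"
      by (subst f) (simp add: degree_add_eq_left)
    moreover have sub: "?A f - {c} \<subseteq> ?A h"
    proof safe
      fix d assume d: "d \<in> K" "poly f d \<in> K" "d \<notin> {}" "d \<noteq> c"
      have "poly (f - [:poly f c:]) d = (d - c) * poly h d"
        by (simp add: h algebra_simps)
      then have "poly h d = (poly f d - poly f c) / (d - c)"
        using d by (simp add: field_simps)
      then show "poly h d \<in> K" using c d by auto
    qed
    moreover have "infinite (?A h)"
      by (rule infinite_super[OF sub]) (use less.prems in simp)
    ultimately show ?thesis using less.hyps[of h] by simp
  qed simp
  then have "[:-c, 1:] * h + [:poly f c:] \<in> polys"
    using c by (intro add_in_polys mult_in_polys) auto
  then show ?case by (simp only: f[symmetric])
qed

text \<open>Away from the finitely many zeros of \<open>g\<close>, the values of \<open>f\<close> on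
  \<open>K\<close> are quotients of elements of \<open>K\<close>.\<close>

lemma polys_divide:
  assumes "f * g \<in> polys" "g \<in> polys" "g \<noteq> 0"
  shows "f \<in> polys"
proof (rule polysI_infinite)
  have "K - {c. poly g c = 0} \<subseteq> {c \<in> K. poly f c \<in> K}"
  proof safe
    fix c assume "c \<in> K" "poly g c \<noteq> 0"
    then have "poly f c = poly (f * g) c / poly g c" by simp
    then show "poly f c \<in> K" using assms \<open>c \<in> K\<close> by (metis divide_closed poly_closed)
  qed
  then show "infinite {c \<in> K. poly f c \<in> K}"
    using infinite poly_roots_finite[OF assms(3)] by (meson finite_Diff2 finite_subset)
qed

lemma polys_division:
  assumes "f \<in> polys" "h \<in> polys" "lead_coeff f = 1" "degree f > 0"
  obtains q r where "q \<in> polys" "r \<in> polys" "h = q * f + r" "degree r < degree f"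
proof -
  have "\<exists>q r. q \<in> polys \<and> r \<in> polys \<and> h = q * f + r \<and> degree r < degree f"
    using assms(2)
  proof (induction h)
    case 0
    then show ?case using assms by (intro exI[of _ 0]) auto
  next
    case (pCons a h)
    then obtain q r where qr: "q \<in> polys" "r \<in> polys" "h = q * f + r" "degree r < degree f"
      by auto
    \<comment> \<open>Since \<open>f\<close> is monic, subtracting \<open>smult b f\<close> cancels
      the coefficient at \<open>degree f\<close>.\<close>
    define b where "b = coeff (pCons a r) (degree f)"
    define r' where "r' = pCons a r - smult b f"
    have b: "b \<in> K" unfolding b_def by (rule coeff_closed) (use pCons qr in auto)
    have "coeff r' i = 0" if "i \<ge> degree f" for i
      using that qr(4) assms(3)
      by (cases "i = degree f") (auto simp: r'_def b_def coeff_eq_0 coeff_pCons split: nat.splits)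
    then have "degree r' < degree f"
      using assms(4) degree_lessI by blast
    moreover have "pCons a h = pCons b q * f + r'"
      by (simp add: r'_def qr(3))
    ultimately show ?case
      using b qr pCons.prems assms(1)
      by (intro exI[of _ "pCons b q"] exI[of _ r'])
        (auto simp: r'_def intro!: diff_in_polys smult_in_polys)
  qed
  then show ?thesis using that by blast
qed

end

section \<open>Products over sets of root indices\<close>

lemma alg_closed_factorization_indexed:
  fixes f :: "'b :: alg_closed_field poly"
  assumes "f \<noteq> 0"
  obtains x where "f = smult (lead_coeff f) (\<Prod>i<degree f. [:- x i, 1:])"
proof -
  obtain A where A: "size A = degree f" "f = smult (lead_coeff f) (\<Prod>x\<in>#A. [:-x, 1:])"
    using alg_closed_imp_factorization[OF assms] by blast
  obtain xs where xs: "A = mset xs" by (metis ex_mset)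
  have "(\<Prod>x\<in>#A. [:-x, 1:]) = prod_list (map (\<lambda>x. [:-x, 1:]) xs)"
    by (simp add: xs flip: mset_map prod_mset_prod_list)
  also have "\<dots> = (\<Prod>i<degree f. [:- (xs ! i), 1:])"
    using A(1) by (simp add: prod.list_conv_set_nth xs atLeast0LessThan)
  finally show ?thesis using that[of "\<lambda>i. xs ! i"] A(2) by simp
qed

lemma degree_prod_linear [simp]:
  "degree (\<Prod>i\<in>I. [:- z i, 1 :: 'b :: field:]) = card I"
  by (subst degree_prod_sum_eq) auto

lemma lead_coeff_prod_linear [simp]:
  "coeff (\<Prod>i\<in>I. [:- z i, 1 :: 'b :: field:]) (card I) = 1"
  using lead_coeff_prod[of "\<lambda>i. [:- z i, 1:]" I] by simp

lemma prod_linear_nonzero [simp]: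
  "(\<Prod>i\<in>I. [:- z i, 1 :: 'b :: field:]) \<noteq> 0"
  by (metis lead_coeff_prod_linear coeff_0 zero_neq_one)

text \<open>Sets of indices rather than of roots, so that repeated roots count with
  multiplicity.\<close>

definition subsets :: "nat \<Rightarrow> nat \<Rightarrow> nat set set" where
  "subsets n k = {S. S \<subseteq> {..<n} \<and> card S = k}"

lemma finite_subsets [simp]: "finite (subsets n k)"
  unfolding subsets_def by (rule finite_subset[of _ "Pow {..<n}"]) auto

lemma card_subsets: "card (subsets n k) = n choose k"
  unfolding subsets_def using n_subsets[of "{..<n}" k] by simp

lemma finite_in_subsets: "S \<in> subsets n k \<Longrightarrow> finite S"
  by (auto simp: subsets_def intro: finite_subset)

lemma subsets_0: "subsets n 0 = {{}}"
  by (auto simp: subsets_def card_eq_0_iff dest: finite_subset)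

text \<open>Double counting: pairs of \<open>S\<close> and \<open>i\<close> outside \<open>S\<close>
  correspond to pairs of \<open>T\<close> and \<open>i\<close> in \<open>T\<close> by
  \<open>T = insert i S\<close>.\<close>

lemma prod_subsets_Suc:
  fixes g :: "nat set \<Rightarrow> nat \<Rightarrow> 'c :: comm_monoid_mult"
  shows "(\<Prod>S\<in>subsets n k. \<Prod>i\<in>{..<n} - S. g S i) =
    (\<Prod>T\<in>subsets n (Suc k). \<Prod>i\<in>T. g (T - {i}) i)"
proof -
  have "(\<Prod>S\<in>subsets n k. \<Prod>i\<in>{..<n} - S. g S i) =
    (\<Prod>(S, i)\<in>Sigma (subsets n k) (\<lambda>S. {..<n} - S). g S i)"
    by (rule prod.Sigma) auto
  also have "\<dots> = (\<Prod>(T, i)\<in>Sigma (subsets n (Suc k)) (\<lambda>T. T). g (T - {i}) i)"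
    by (rule prod.reindex_bij_witness[of _ "\<lambda>(T, i). (T - {i}, i)" "\<lambda>(S, i). (insert i S, i)"])
      (auto simp: subsets_def finite_subset card_insert_if insert_absorb)
  also have "\<dots> = (\<Prod>T\<in>subsets n (Suc k). \<Prod>i\<in>T. g (T - {i}) i)"
    by (rule prod.Sigma[symmetric]) (auto dest: finite_in_subsets)
  finally show ?thesis .
qed

text \<open>Takes the place of the elementary symmetric polynomial of degree \<open>k\<close>: its
  monomials become roots instead of summands.\<close>

definition subset_products_poly :: "(nat \<Rightarrow> 'b :: field) \<Rightarrow> nat \<Rightarrow> nat \<Rightarrow> 'b poly" where
  "subset_products_poly y n k = (\<Prod>S\<in>subsets n k. [:- (\<Prod>i\<in>S. y i), 1:])"

text \<open>
  The correction terms in the analogue of Newton's identities: monomials in which one variable has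
  exponent \<open>r\<close> and \<open>k\<close> others have exponent 1.
\<close>
definition hook_products_poly :: "(nat \<Rightarrow> 'b :: field) \<Rightarrow> nat \<Rightarrow> nat \<Rightarrow> nat \<Rightarrow> 'b poly" where
  "hook_products_poly y n k r =
    (\<Prod>S\<in>subsets n k. \<Prod>i\<in>{..<n} - S. [:- ((\<Prod>j\<in>S. y j) * y i ^ r), 1:])"

text \<open>Each set of size \<open>Suc k\<close> arises \<open>Suc k\<close> times, once for each
  choice of the removed index.\<close>

lemma hook_products_poly_1:
  "hook_products_poly y n k 1 = subset_products_poly y n (Suc k) ^ Suc k"
proof -
  have "(\<Prod>j\<in>T - {i}. y j) * y i ^ 1 = (\<Prod>j\<in>T. y j)" if "T \<in> subsets n (Suc k)" "i \<in> T" for T i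
    using prod.remove[OF finite_in_subsets[OF that(1)] that(2), of y] by (simp add: mult.commute)
  then have "hook_products_poly y n k 1 =
      (\<Prod>T\<in>subsets n (Suc k). \<Prod>i\<in>T. [:- (\<Prod>j\<in>T. y j), 1:])"
    unfolding hook_products_poly_def prod_subsets_Suc by (intro prod.cong refl) auto
  also have "\<dots> = (\<Prod>T\<in>subsets n (Suc k). [:- (\<Prod>j\<in>T. y j), 1:] ^ Suc k)"
    by (intro prod.cong refl) (simp add: subsets_def)
  finally show ?thesis by (simp only: subset_products_poly_def prod_power_distrib)
qed

text \<open>Multiplying the monomial of \<open>S\<close> by \<open>y i ^ r\<close> gives a hook of
  exponent \<open>r\<close> if \<open>i\<close> is outside \<open>S\<close>, and of exponent
  \<open>Suc r\<close> if \<open>i\<close> is in \<open>S\<close>.\<close>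

lemma hook_products_poly_mult:
  "hook_products_poly y n (Suc k) r * hook_products_poly y n k (Suc r) =
    (\<Prod>S\<in>subsets n (Suc k). \<Prod>i<n. [:- ((\<Prod>j\<in>S. y j) * y i ^ r), 1:])"
proof -
  have "(\<Prod>j\<in>T - {i}. y j) * y i ^ Suc r = (\<Prod>j\<in>T. y j) * y i ^ r"
    if "T \<in> subsets n (Suc k)" "i \<in> T" for T i
    using prod.remove[OF finite_in_subsets[OF that(1)] that(2), of y] by (simp add: mult_ac)
  then have "hook_products_poly y n k (Suc r) =
      (\<Prod>T\<in>subsets n (Suc k). \<Prod>i\<in>T. [:- ((\<Prod>j\<in>T. y j) * y i ^ r), 1:])"
    unfolding hook_products_poly_def prod_subsets_Suc by (intro prod.cong refl) auto
  then have "hook_products_poly y n (Suc k) r * hook_products_poly y n k (Suc r) =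
      (\<Prod>S\<in>subsets n (Suc k). (\<Prod>i\<in>{..<n} - S. [:- ((\<Prod>j\<in>S. y j) * y i ^ r), 1:]) *
        (\<Prod>i\<in>S. [:- ((\<Prod>j\<in>S. y j) * y i ^ r), 1:]))"
    by (simp only: hook_products_poly_def[of y n "Suc k"] prod.distrib)
  also have "\<dots> = (\<Prod>S\<in>subsets n (Suc k). \<Prod>i<n. [:- ((\<Prod>j\<in>S. y j) * y i ^ r), 1:])"
    by (intro prod.cong refl prod.subset_diff[symmetric]) (auto simp: subsets_def)
  finally show ?thesis .
qed

section \<open>Descent of coefficients to the subfield\<close>

locale subfield_of_alg_closed = infinite_subfield K for K :: "'b :: alg_closed_field set"
begin

text \<open>
  This product is a resultant, so one can run the Euclidean algorithm: reduce \<open>h\<close> modulo the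
  polynomial with roots \<open>y i\<close>, then exchange the two polynomials.
\<close>
lemma prod_poly_roots_closed:
  fixes y :: "nat \<Rightarrow> 'b"
  assumes "(\<Prod>i<n. [:- y i, 1:]) \<in> polys" "h \<in> polys"
  shows "(\<Prod>i<n. poly h (y i)) \<in> K"
  using assms
proof (induction n arbitrary: y h rule: less_induct)
  case (less n)
  define f where "f = (\<Prod>i<n. [:- y i, 1:])"
  show ?case
  proof (cases "n = 0")
    case False
    have f: "f \<in> polys" "degree f = n" "lead_coeff f = 1"
      using less.prems(1) lead_coeff_prod_linear[of y "{..<n}"] by (simp_all add: f_def)
    obtain q r where "q \<in> polys" and qr: "r \<in> polys" "h = q * f + r" "degree r < n"
      using polys_division[OF f(1) less.prems(2) f(3)] False f(2) by blast
    have "poly f (y i) = 0" if "i < n" for i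
      unfolding f_def poly_prod using that by (intro prod_zero) auto
    then have eq: "(\<Prod>i<n. poly h (y i)) = (\<Prod>i<n. poly r (y i))"
      by (intro prod.cong) (auto simp: qr(2))
    show ?thesis
    proof (cases "r = 0")
      case True
      then show ?thesis using False by (simp add: eq zero_power)
    next
      case r: False
      define l m where "l = lead_coeff r" and "m = degree r"
      obtain z where z: "r = smult l (\<Prod>j<m. [:- z j, 1:])"
        unfolding l_def m_def using alg_closed_factorization_indexed[OF r] by blast
      have l: "l \<in> K" "l \<noteq> 0" using r qr(1) by (auto simp: l_def coeff_closed)
      have "(\<Prod>j<m. [:- z j, 1:]) = smult (inverse l) r"
        using l(2) by (subst z) simp
      then have "(\<Prod>j<m. [:- z j, 1:]) \<in> polys"
        using l qr(1) by (auto intro: smult_in_polys)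
      then have IH: "(\<Prod>j<m. poly f (z j)) \<in> K"
        using less.IH[of m z f] qr(3) less.prems(1) by (simp add: m_def f_def)
      have "(\<Prod>i<n. poly r (y i)) = l ^ n * (\<Prod>i<n. \<Prod>j<m. y i - z j)"
        by (subst z) (simp add: poly_prod prod.distrib)
      \<comment> \<open>Up to sign, values of the monic part of \<open>r\<close> at the roots of
        \<open>f\<close> become values of \<open>f\<close> at the roots of \<open>r\<close>.\<close>
      also have "(\<Prod>i<n. \<Prod>j<m. y i - z j) = (\<Prod>j<m. \<Prod>i<n. (-1) * (z j - y i))"
        by (subst prod.swap) simp
      also have "\<dots> = ((-1) ^ n) ^ m * (\<Prod>j<m. poly f (z j))"
        by (simp only: prod.distrib prod_constant card_lessThan f_def poly_prod) simp
      finally show ?thesis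
        using eq l IH by (auto intro!: mult_closed power_closed uminus_closed)
    qed
  qed simp
qed

text \<open>At \<open>t\<close> \<noteq> 0 the value is a power of \<open>t\<close> times the value
  of the given polynomial at \<open>c / t\<close>.\<close>

lemma reversed_prod_in_polys:
  assumes "(\<Prod>a\<in>A. [:- z a, 1:]) \<in> polys" "c \<in> K"
  shows "(\<Prod>a\<in>A. [:c, - z a:]) \<in> polys"
proof (rule polysI_infinite, rule infinite_super)
  show "infinite (K - {0})" using infinite by simp
  show "K - {0} \<subseteq> {t \<in> K. poly (\<Prod>a\<in>A. [:c, - z a:]) t \<in> K}"
  proof safe
    fix t assume t: "t \<in> K" "t \<noteq> 0"
    have "poly (\<Prod>a\<in>A. [:c, - z a:]) t = (\<Prod>a\<in>A. t * (c / t - z a))"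
      using t by (auto simp: poly_prod algebra_simps intro!: prod.cong)
    also have "\<dots> = t ^ card A * poly (\<Prod>a\<in>A. [:- z a, 1:]) (c / t)"
      by (simp add: prod.distrib poly_prod)
    finally show "poly (\<Prod>a\<in>A. [:c, - z a:]) t \<in> K"
      using t assms by (auto intro!: mult_closed poly_closed divide_closed power_closed)
  qed
qed

lemma prod_products_in_polys:
  fixes y :: "nat \<Rightarrow> 'b"
  assumes "(\<Prod>a\<in>A. [:- z a, 1:]) \<in> polys" "(\<Prod>i<n. [:- y i, 1:]) \<in> polys"
  shows "(\<Prod>a\<in>A. \<Prod>i<n. [:- (z a * y i ^ r), 1:]) \<in> polys"
proof (rule polysI_infinite, rule infinite_super)
  show "infinite K" by (rule infinite)
  show "K \<subseteq> {c \<in> K. poly (\<Prod>a\<in>A. \<Prod>i<n. [:- (z a * y i ^ r), 1:]) c \<in> K}"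
  proof safe
    fix c assume c: "c \<in> K"
    \<comment> \<open>The value of \<open>h\<close> at \<open>y i\<close> is the product over
      \<open>a\<close> of \<open>c - z a * y i ^ r\<close>.\<close>
    define h where "h = pcompose (\<Prod>a\<in>A. [:c, - z a:]) (monom 1 r)"
    have monom: "monom 1 r \<in> polys" by (auto simp: polys_def)
    have "(\<Prod>i<n. poly h (y i)) \<in> K"
      unfolding h_def
      by (rule prod_poly_roots_closed[OF assms(2)
          pcompose_in_polys[OF reversed_prod_in_polys[OF assms(1) c] monom]])
    also have "(\<Prod>i<n. poly h (y i)) = poly (\<Prod>a\<in>A. \<Prod>i<n. [:- (z a * y i ^ r), 1:]) c"
      by (subst prod.swap) (simp add: h_def poly_pcompose poly_prod poly_monom algebra_simps)
    finally show "poly (\<Prod>a\<in>A. \<Prod>i<n. [:- (z a * y i ^ r), 1:]) c \<in> K" .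
  qed
qed

text \<open>Recursion through \<open>hook_products_poly_mult\<close>, dividing by the factor with
  smaller \<open>k\<close>; its exponent is \<open>Suc r\<close>, so \<open>r\<close> stays
  arbitrary.\<close>

lemma hook_products_poly_in_polys:
  assumes "\<And>j. j \<le> k \<Longrightarrow> subset_products_poly y n j \<in> polys"
    and "(\<Prod>i<n. [:- y i, 1:]) \<in> polys"
  shows "hook_products_poly y n k r \<in> polys"
  using assms(1)
proof (induction k arbitrary: r)
  case 0
  have "(\<Prod>S\<in>subsets n 0. \<Prod>i<n. [:- ((\<Prod>j\<in>S. y j) * y i ^ r), 1:]) \<in> polys"
    using 0 unfolding subset_products_poly_def by (intro prod_products_in_polys assms(2)) auto
  then show ?case by (simp add: hook_products_poly_def subsets_0)
next
  case (Suc k)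
  have "hook_products_poly y n (Suc k) r * hook_products_poly y n k (Suc r) \<in> polys"
    unfolding hook_products_poly_mult
    using Suc.prems unfolding subset_products_poly_def
    by (intro prod_products_in_polys assms(2)) auto
  moreover have "hook_products_poly y n k (Suc r) \<noteq> 0"
    by (auto simp: hook_products_poly_def)
  ultimately show ?case
    using Suc polys_divide by (meson le_SucI)
qed

text \<open>
  On \<open>K\<close> the values of \<open>f\<close> lie in \<open>K\<close> up to an \<open>m\<close>-th root of unity; the same root of unity occurs
  infinitely often, and \<open>f\<close> being monic forces it to lie in \<open>K\<close>.
\<close>
lemma root_in_polys:
  assumes roots: "\<And>a. a \<in> K \<Longrightarrow> \<exists>b\<in>K. b ^ m = a"
    and "f ^ m \<in> polys" "lead_coeff f = 1" "m > 0"
  shows "f \<in> polys"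
proof -
  have "\<exists>u. u ^ m = 1 \<and> poly f c / u \<in> K" if c: "c \<in> K" for c
  proof (cases "poly f c = 0")
    case False
    obtain b where b: "b \<in> K" "b ^ m = poly f c ^ m"
      using roots[of "poly f c ^ m"] poly_closed[OF assms(2) c] by auto
    then have "b \<noteq> 0" using False assms(4) by (auto simp: power_0_left)
    then show ?thesis
      using b False by (intro exI[of _ "poly f c / b"]) (auto simp: power_divide)
  qed (auto intro: exI[of _ 1])
  then obtain u where u: "\<And>c. c \<in> K \<Longrightarrow> u c ^ m = 1" "\<And>c. c \<in> K \<Longrightarrow> poly f c / u c \<in> K"
    by metis
  have "finite {x. poly (monom 1 m - 1 :: 'b poly) x = 0}"
  proof (rule poly_roots_finite)
    have "degree (monom 1 m :: 'b poly) = m" by (rule degree_monom_eq) simp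
    then show "monom 1 m - 1 \<noteq> (0 :: 'b poly)" using assms(4) by auto
  qed
  moreover have "u ` K \<subseteq> {x. poly (monom 1 m - 1 :: 'b poly) x = 0}"
    using u(1) by (auto simp: poly_monom)
  ultimately have "finite (u ` K)" by (rule rev_finite_subset)
  then obtain c0 where c0: "c0 \<in> K" "infinite {c \<in> K. u c = u c0}"
    using pigeonhole_infinite[OF infinite] by blast
  define w where "w = inverse (u c0)"
  have [simp]: "u c0 \<noteq> 0" using u(1)[OF c0(1)] assms(4) by (metis power_0_left zero_neq_one neq0_conv)
  have "{c \<in> K. u c = u c0} \<subseteq> {c \<in> K. poly (smult w f) c \<in> K}"
    using u(2) by (force simp: w_def field_simps)
  then have wf: "smult w f \<in> polys"
    using c0(2) by (intro polysI_infinite) (rule infinite_super)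
  then have "w \<in> K" using coeff_closed[OF wf, of "degree f"] assms(3) by simp
  then have "smult (inverse w) (smult w f) \<in> polys"
    by (intro smult_in_polys inverse_closed wf)
  then show ?thesis by (simp add: w_def)
qed

text \<open>Newton's division by \<open>k\<close> becomes extraction of a \<open>k\<close>-th root,
  so the characteristic does not matter.\<close>

lemma subset_products_poly_in_polys:
  assumes roots: "\<And>m a. m > 0 \<Longrightarrow> a \<in> K \<Longrightarrow> \<exists>b\<in>K. b ^ m = a"
    and "(\<Prod>i<n. [:- y i, 1:]) \<in> polys"
  shows "subset_products_poly y n k \<in> polys"
proof (induction k rule: less_induct)
  case (less k)
  show ?case
  proof (cases k)
    case 0
    then show ?thesis by (auto simp: subset_products_poly_def subsets_0)
  next
    case (Suc l)
    have "hook_products_poly y n l 1 \<in> polys"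
      by (rule hook_products_poly_in_polys) (use less Suc assms(2) in auto)
    then show ?thesis
      unfolding hook_products_poly_1 Suc
      by (rule root_in_polys[rotated])
        (auto intro: roots simp del: power_Suc simp: subset_products_poly_def)
  qed
qed

end

section \<open>Laplace's induction on the multiplicity of a prime\<close>

lemma multiplicity_choose_less:
  fixes p n :: nat
  assumes "prime p" "p dvd n" "n > 0"
  shows "multiplicity p (n choose p) < multiplicity p n"
proof -
  obtain m where m: "n = p * m" using assms(2) by (elim dvdE)
  \<comment> \<open>\<open>n choose p\<close> is \<open>m\<close> times
    \<open>(n - 1) choose (p - 1)\<close>, and \<open>p\<close> does not divide the latter.\<close>
  have "multiplicity p (n choose p) = multiplicity p m"
    using const_p_fac[of m p 1] assms m by simp
  moreover have "multiplicity p n = Suc (multiplicity p m)"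
    using assms m by (auto intro!: multiplicity_times_same)
  ultimately show ?thesis by simp
qed

locale prime_degree_roots = subfield_of_alg_closed +
  assumes prime_root: "\<And>f. f \<in> polys \<Longrightarrow> prime (degree f) \<Longrightarrow> \<exists>x\<in>K. poly f x = 0"
begin

text \<open>Roots of prime order are roots of \<open>monom 1 q - [:a:]\<close>; the others follow by
  splitting off prime factors of \<open>m\<close>.\<close>

lemma nth_root_closed:
  assumes "a \<in> K" "m > 0"
  shows "\<exists>b\<in>K. b ^ m = a"
  using assms
proof (induction m arbitrary: a rule: less_induct)
  case (less m)
  show ?case
  proof (cases "m = 1")
    case False
    then obtain q where q: "prime q" "q dvd m" using prime_factor_nat by blast
    then obtain k where k: "m = q * k" by (elim dvdE)
    define f where "f = monom 1 q - [:a:]"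
    have q0: "q > 0" "q > 1" using prime_gt_0_nat[OF q(1)] prime_gt_1_nat[OF q(1)] by auto
    have "degree f = q"
      unfolding f_def diff_conv_add_uminus
      by (subst degree_add_eq_left) (use q0 in \<open>auto simp: degree_monom_eq\<close>)
    moreover have "monom 1 q \<in> polys" by (auto simp: polys_def)
    then have "f \<in> polys"
      using less.prems(1) by (auto simp: f_def intro!: diff_in_polys)
    ultimately obtain b where b: "b \<in> K" "poly f b = 0" using prime_root q(1) by blast
    have "k < m" "k > 0" using k less.prems(2) q0 by auto
    then obtain c where "c \<in> K" "c ^ k = b" using less.IH b(1) by blast
    then show ?thesis
      using b(2) by (intro bexI[of _ c]) (auto simp: f_def poly_monom k mult.commute[of q] power_mult)
  qed (use less.prems in auto)
qed

lemma prime_dividing_rootless_degrees: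
  obtains p :: nat where "prime p" "\<And>f. f \<in> polys \<Longrightarrow> \<not> p dvd degree f \<Longrightarrow> \<exists>x\<in>K. poly f x = 0"
proof -
  define B where "B = degree ` {f \<in> polys. \<forall>x\<in>K. poly f x \<noteq> 0}"
  have add: "a + b \<in> B" if ab: "a \<in> B" "b \<in> B" for a b
  proof -
    obtain f g where f: "a = degree f" "f \<in> polys" "\<forall>x\<in>K. poly f x \<noteq> 0"
      and g: "b = degree g" "g \<in> polys" "\<forall>x\<in>K. poly g x \<noteq> 0"
      using ab unfolding B_def by blast
    have "f \<noteq> 0" "g \<noteq> 0" using f g by auto
    then show ?thesis
      using f g by (auto simp: B_def degree_mult_eq intro!: image_eqI[of _ _ "f * g"] mult_in_polys)
  qed
  have zero: "0 \<in> B"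
    unfolding B_def by (rule image_eqI[of _ _ 1]) auto
  have no_prime: "\<not> prime b" if "b \<in> B" for b
    using that prime_root by (auto simp: B_def)
  obtain p where p: "prime p" "\<And>b. b \<in> B \<Longrightarrow> p dvd b"
    using numerical_semigroup_without_primes[OF add zero no_prime] by blast
  show ?thesis
    by (rule that[OF p(1)]) (use p(2) in \<open>auto simp: B_def\<close>)
qed

theorem root_in_subfield:
  assumes "f \<in> polys" "degree f > 0"
  shows "\<exists>x\<in>K. poly f x = 0"
proof -
  obtain p where p: "prime p"
    and coprime_root: "\<And>f. f \<in> polys \<Longrightarrow> \<not> p dvd degree f \<Longrightarrow> \<exists>x\<in>K. poly f x = 0"
    using prime_dividing_rootless_degrees by blast
  show ?thesis
    using assms
  proof (induction "multiplicity p (degree f)" arbitrary: f rule: less_induct)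
    case less
    show ?case
    proof (cases "p dvd degree f")
      case True
      define n where "n = degree f"
      have n: "p dvd n" "n > 0" "p \<le> n" using True less.prems(2) by (auto simp: n_def dvd_imp_le)
      have "f \<noteq> 0" using less.prems(2) by auto
      then obtain x where x: "f = smult (lead_coeff f) (\<Prod>i<n. [:- x i, 1:])"
        unfolding n_def using alg_closed_factorization_indexed by blast
      define g where "g = (\<lambda>S. \<Prod>i\<in>S. [:- x i, 1:])"
      have "\<exists>S\<in>subsets n p. poly (g S) c \<in> K" if c: "c \<in> K" for c
      proof -
        have "smult (inverse (lead_coeff f)) f \<in> polys"
          using less.prems(1) by (auto intro!: smult_in_polys coeff_closed)
        moreover have "smult (inverse (lead_coeff f)) f = (\<Prod>i<n. [:- x i, 1:])"
          using \<open>f \<noteq> 0\<close> by (subst (2) x) simp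
        \<comment> \<open>Substituting X + c shifts the roots to \<open>x i - c\<close>.\<close>
        ultimately have "pcompose (\<Prod>i<n. [:- x i, 1:]) [:c, 1:] \<in> polys"
          using c by (intro pcompose_in_polys) auto
        also have "pcompose (\<Prod>i<n. [:- x i, 1:]) [:c, 1:] = (\<Prod>i<n. [:- (x i - c), 1:])"
          by (simp add: pcompose_prod pcompose_pCons)
        finally have "subset_products_poly (\<lambda>i. x i - c) n p \<in> polys"
          by (intro subset_products_poly_in_polys nth_root_closed)
        moreover have deg: "degree (subset_products_poly (\<lambda>i. x i - c) n p) = n choose p"
          by (simp add: subset_products_poly_def card_subsets)
        moreover have "multiplicity p (n choose p) < multiplicity p (degree f)"
          using multiplicity_choose_less[OF p n(1,2)] by (simp add: n_def)
        moreover have "n choose p > 0" using n(3) by (simp add: zero_less_binomial_iff)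
        ultimately obtain t where t: "t \<in> K" "poly (subset_products_poly (\<lambda>i. x i - c) n p) t = 0"
          using less.hyps by metis
        then obtain S where S: "S \<in> subsets n p" "t = (\<Prod>i\<in>S. x i - c)"
          by (auto simp: subset_products_poly_def poly_prod)
        have "poly (g S) c = (\<Prod>i\<in>S. (-1) * (x i - c))"
          by (simp add: g_def poly_prod)
        also have "\<dots> = (-1) ^ card S * t"
          by (simp only: prod.distrib prod_constant S(2))
        finally show ?thesis
          using S(1) t(1) by (auto intro!: bexI[of _ S] mult_closed power_closed uminus_closed)
      qed
      then obtain s where s: "\<And>c. c \<in> K \<Longrightarrow> s c \<in> subsets n p \<and> poly (g (s c)) c \<in> K"
        by metis
      then have "finite (s ` K)" by (intro finite_subset[OF _ finite_subsets[of n p]]) auto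
      then obtain c0 where c0: "c0 \<in> K" "infinite {c \<in> K. s c = s c0}"
        using pigeonhole_infinite[OF infinite] by blast
      define S where "S = s c0"
      have S: "S \<in> subsets n p" using s c0(1) by (simp add: S_def)
      have "{c \<in> K. s c = s c0} \<subseteq> {c \<in> K. poly (g S) c \<in> K}"
        using s by (auto simp: S_def) metis
      then have "g S \<in> polys" using c0(2) by (intro polysI_infinite) (rule infinite_super)
      moreover have "degree (g S) = p" using S by (simp add: g_def subsets_def)
      ultimately obtain r where r: "r \<in> K" "poly (g S) r = 0" using prime_root p by blast
      then obtain i where "i \<in> S" "r = x i"
        using finite_in_subsets[OF S] by (auto simp: g_def poly_prod)
      then have "poly (\<Prod>i<n. [:- x i, 1:]) r = 0"
        using S by (auto simp: poly_prod subsets_def)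
      then have "poly f r = 0" by (subst x) simp
      then show ?thesis using r(1) by blast
    qed (use coprime_root less.prems in blast)
  qed
qed

end

section \<open>Transfer to the algebraic closure\<close>

lemma infinite_if_prime_degree_roots:
  assumes "\<And>f :: 'a::field poly. prime (degree f) \<Longrightarrow> \<exists>x. poly f x = 0"
  shows "infinite (UNIV :: 'a set)"
proof
  assume fin: "finite (UNIV :: 'a set)"
  obtain q where q: "prime q" "q > card (UNIV :: 'a set)" using bigger_prime by blast
  \<comment> \<open>\<open>h\<close> vanishes everywhere, so \<open>h + 1\<close> has no root; the
    power of X raises the degree to \<open>q\<close>.\<close>
  define h where "h = (\<Prod>a\<in>UNIV. [:- a, 1 :: 'a:]) * monom 1 (q - card (UNIV :: 'a set))"
  have "degree h = q"
    using q(2) unfolding h_def by (subst degree_mult_eq) (auto simp: degree_monom_eq)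
  then have "degree (h + 1) = q"
    using q(1) by (subst degree_add_eq_left) (auto simp: prime_gt_0_nat)
  then obtain x where "poly (h + 1) x = 0" using assms q(1) by metis
  moreover have "poly (\<Prod>a\<in>UNIV. [:- a, 1:]) x = 0"
    using fin by (auto simp: poly_prod)
  then have "poly h x = 0" by (simp add: h_def)
  ultimately show False by simp
qed

lemma poly_map_poly_to_ac: "poly (map_poly to_ac f) (to_ac x) = to_ac (poly f x)"
  by (induction f) (auto simp: map_poly_pCons)

theorem theorem3p1:
  assumes "\<And>f :: 'a::field poly. prime (degree f) \<Longrightarrow> \<exists>x. poly f x = 0"
  shows "OFCLASS('a, alg_closed_field_class)"
proof -
  define K where "K = range (to_ac :: 'a \<Rightarrow> 'a alg_closure)"
  interpret infinite_subfield K
  proof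
    show "infinite K"
      unfolding K_def using infinite_if_prime_degree_roots[OF assms]
      by (simp add: finite_image_iff inj_to_ac)
  qed (auto simp: K_def simp flip: to_ac_add to_ac_minus to_ac_mult to_ac_inverse to_ac_0 to_ac_1)
  have deg: "degree (map_poly to_ac f) = degree f" for f :: "'a poly"
    by (rule degree_map_poly) simp
  have root_iff: "(\<exists>y\<in>K. poly (map_poly to_ac f) y = 0) \<longleftrightarrow> (\<exists>x. poly f x = 0)" for f :: "'a poly"
    by (auto simp: K_def poly_map_poly_to_ac)
  have map_poly: "map_poly to_ac f \<in> polys" for f :: "'a poly"
    unfolding polys_def by (auto simp: K_def coeff_map_poly)
  have polysE: "\<exists>f :: 'a poly. g = map_poly to_ac f" if "g \<in> polys" for g
  proof -
    \<comment> \<open>\<open>coeff_map_poly\<close> needs a map that preserves 0.\<close>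
    have "inv_into UNIV to_ac (0 :: 'a alg_closure) = (0 :: 'a)"
      using inv_into_f_f[OF inj_to_ac UNIV_I, of 0] by simp
    then have "g = map_poly to_ac (map_poly (inv_into UNIV to_ac) g)"
      using coeff_closed[OF that]
      by (intro poly_eqI) (auto simp: K_def coeff_map_poly f_inv_into_f)
    then show ?thesis by blast
  qed
  interpret prime_degree_roots K
  proof
    fix g assume "g \<in> polys" "prime (degree g)"
    then show "\<exists>x\<in>K. poly g x = 0" using assms deg root_iff polysE by metis
  qed
  show "OFCLASS('a, alg_closed_field_class)"
  proof (rule alg_closedI)
    fix f :: "'a poly" assume "degree f > 0"
    then show "\<exists>x. poly f x = 0" using root_in_subfield[OF map_poly] deg root_iff by metis
  qed
qed

end
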